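(* Let $f,g:\mathbb{R}^n\times\mathbb{R}^m\to\mathbb{R}$ satisfy Assumptions (A1), (A2), (A3) of the context, let $h(z)=\|\nabla_y g(z)\|^2$, and let $\varepsilon>0$, $\alpha_b>0$, $w>0$. For $z\in\mathbb{R}^{n+m}$ consider the problem in the variable $\Delta z\in\mathbb{R}^{n+m}$ $$\min_{\Delta z}\ \tfrac12\|\Delta z+\nabla f(z)\|^2\quad\text{s.t.}\quad \nabla h(z)^\top\Delta z+\alpha_b\,(h(z)-\varepsilon^2)\le -w\|\Delta z\|^2,\qquad (\mathrm{QCQP}_z)$$ and, whenever it is feasible, let $\Delta z$ also denote its (unique) minimizer. Then: (i) If $h(z)\le\varepsilon^2$, then $(\mathrm{QCQP}_z)$ is strictly feasible, i.e. some vector satisfies the constraint with strict inequality. (ii) If $h(z)\le\varepsilon^2$, then the minimizer $\Delta z$ satisfies $\nabla f(z)^\top\Delta z\le-\|\Delta z\|^2$. (iii) If $h(z)>\varepsilon^2$ and the minimizer $\Delta z$ exists, then $$\nabla h(z)^\top\Delta z\le-\alpha_b\,(h(z)-\varepsilon^2)-w\|\Delta z\|^2\le 0.$$ (iv) If $z$ satisfies the KKT conditions of the problem $\min_{z} f(z)$ s.t. $h(z)-\varepsilon^2\le 0$ (as written in the context), then the minimizer of $(\mathrm{QCQP}_z)$ is $\Delta z=0$.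
   Context: Write $z=(x,y)\in\mathbb{R}^{n+m}$ with $x\in\mathbb{R}^n$, $y\in\mathbb{R}^m$; $\|\cdot\|$ is the Euclidean norm. $\nabla_y g(z)\in\mathbb{R}^m$ is the partial gradient in $y$, and $\nabla^2_{yx}g(z)\in\mathbb{R}^{m\times n}$, $\nabla^2_{yy}g(z)\in\mathbb{R}^{m\times m}$ are the Jacobians of $\nabla_y g$ with respect to $x$ and $y$. Assumptions: (A1) $f$ is continuously differentiable and $\nabla f$ is locally Lipschitz continuous. (A2) $g$ is twice continuously differentiable and $\nabla^2_{yx}g$, $\nabla^2_{yy}g$ are locally Lipschitz continuous. (A3) For all $z$ with $\nabla_y g(z)\ne0$, $\nabla_y g(z)\notin\mathcal{N}\big([\nabla^2_{yx}g(z)\ \ \nabla^2_{yy}g(z)]^\top\big)$, where $\mathcal{N}$ denotes the null space. KKT conditions for $\min_z f(z)$ s.t. $h(z)-\varepsilon^2\le0$: there is $\lambda\ge0$ such that $\nabla f(z)+\lambda\nabla h(z)=0$, $h(z)-\varepsilon^2\le0$, and $\lambda\,(h(z)-\varepsilon^2)=0$. *)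

theory Defs
  imports "HOL-Analysis.Analysis"
begin

definition grad :: "('a::real_inner \<Rightarrow> real) \<Rightarrow> 'a \<Rightarrow> 'a" where
  "grad f z = (THE D. GDERIV f z :> D)"

text \<open>Points \<open>z = (x, y)\<close> live in the product space \<open>real ^ 'n \<times> real ^ 'm\<close>, whose library
  inner product and norm are the Euclidean ones of the concatenated vector.\<close>

definition grad_y :: "('a \<times> 'b::real_inner \<Rightarrow> real) \<Rightarrow> 'a \<times> 'b \<Rightarrow> 'b" where
  "grad_y g z = grad (\<lambda>y. g (fst z, y)) (snd z)"

definition hess_yx :: "((real ^ 'n) \<times> (real ^ 'm) \<Rightarrow> real) \<Rightarrow> (real ^ 'n) \<times> (real ^ 'm) \<Rightarrow> real ^ 'n ^ 'm" where
  "hess_yx g z = jacobian (\<lambda>x. grad_y g (x, snd z)) (at (fst z))"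

definition hess_yy :: "((real ^ 'n) \<times> (real ^ 'm) \<Rightarrow> real) \<Rightarrow> (real ^ 'n) \<times> (real ^ 'm) \<Rightarrow> real ^ 'm ^ 'm" where
  "hess_yy g z = jacobian (\<lambda>y. grad_y g (fst z, y)) (at (snd z))"

definition cont_differentiable :: "('a::real_normed_vector \<Rightarrow> 'b::real_normed_vector) \<Rightarrow> bool" where
  "cont_differentiable F \<longleftrightarrow>
     (\<exists>F' :: 'a \<Rightarrow> 'a \<Rightarrow>\<^sub>L 'b. (\<forall>z. (F has_derivative blinfun_apply (F' z)) (at z)) \<and> continuous_on UNIV F')"

definition twice_cont_differentiable :: "('a::real_normed_vector \<Rightarrow> 'b::real_normed_vector) \<Rightarrow> bool" where
  "twice_cont_differentiable F \<longleftrightarrow>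
     (\<exists>F' :: 'a \<Rightarrow> 'a \<Rightarrow>\<^sub>L 'b. (\<forall>z. (F has_derivative blinfun_apply (F' z)) (at z)) \<and> cont_differentiable F')"

text \<open>On matrices the library distance is the Frobenius one; any other norm gives the same notion.\<close>

definition locally_lipschitz :: "('a::metric_space \<Rightarrow> 'b::metric_space) \<Rightarrow> bool" where
  "locally_lipschitz F \<longleftrightarrow> (\<forall>z. \<exists>r>0. \<exists>L. L-lipschitz_on (ball z r) F)"

definition block_row :: "'a ^ 'n ^ 'k \<Rightarrow> 'a ^ 'm ^ 'k \<Rightarrow> 'a ^ ('n + 'm) ^ 'k" where
  "block_row A B = (\<chi> i j. case j of Inl a \<Rightarrow> A $ i $ a | Inr b \<Rightarrow> B $ i $ b)"

definition null_space :: "real ^ 'n ^ 'm \<Rightarrow> (real ^ 'n) set" where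
  "null_space A = {v. A *v v = 0}"

definition assumption_A1 :: "('a::real_inner \<Rightarrow> real) \<Rightarrow> bool" where
  "assumption_A1 f \<longleftrightarrow> cont_differentiable f \<and> locally_lipschitz (grad f)"

definition assumption_A2 :: "((real ^ 'n) \<times> (real ^ 'm) \<Rightarrow> real) \<Rightarrow> bool" where
  "assumption_A2 g \<longleftrightarrow>
     twice_cont_differentiable g \<and> locally_lipschitz (hess_yx g) \<and> locally_lipschitz (hess_yy g)"

definition assumption_A3 :: "((real ^ 'n) \<times> (real ^ 'm) \<Rightarrow> real) \<Rightarrow> bool" where
  "assumption_A3 g \<longleftrightarrow>
     (\<forall>z. grad_y g z \<noteq> 0 \<longrightarrow>
        grad_y g z \<notin> null_space (transpose (block_row (hess_yx g z) (hess_yy g z))))"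

definition KKT_point :: "('a::real_inner \<Rightarrow> real) \<Rightarrow> ('a \<Rightarrow> real) \<Rightarrow> real \<Rightarrow> 'a \<Rightarrow> bool" where
  "KKT_point f h \<epsilon> z \<longleftrightarrow>
     (\<exists>\<mu>\<ge>0. grad f z + \<mu> *\<^sub>R grad h z = 0 \<and> h z - \<epsilon>\<^sup>2 \<le> 0 \<and> \<mu> * (h z - \<epsilon>\<^sup>2) = 0)"

definition qcqp_objective :: "('a::real_inner \<Rightarrow> real) \<Rightarrow> 'a \<Rightarrow> 'a \<Rightarrow> real" where
  "qcqp_objective f z d = 1/2 * (norm (d + grad f z))\<^sup>2"

definition qcqp_feasible ::
    "('a::real_inner \<Rightarrow> real) \<Rightarrow> real \<Rightarrow> real \<Rightarrow> real \<Rightarrow> 'a \<Rightarrow> 'a \<Rightarrow> bool" where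
  "qcqp_feasible h \<epsilon> \<alpha> w z d \<longleftrightarrow>
     grad h z \<bullet> d + \<alpha> * (h z - \<epsilon>\<^sup>2) \<le> - w * (norm d)\<^sup>2"

definition qcqp_strictly_feasible ::
    "('a::real_inner \<Rightarrow> real) \<Rightarrow> real \<Rightarrow> real \<Rightarrow> real \<Rightarrow> 'a \<Rightarrow> 'a \<Rightarrow> bool" where
  "qcqp_strictly_feasible h \<epsilon> \<alpha> w z d \<longleftrightarrow>
     grad h z \<bullet> d + \<alpha> * (h z - \<epsilon>\<^sup>2) < - w * (norm d)\<^sup>2"

definition qcqp_minimizer ::
    "('a::real_inner \<Rightarrow> real) \<Rightarrow> ('a \<Rightarrow> real) \<Rightarrow> real \<Rightarrow> real \<Rightarrow> real \<Rightarrow> 'a \<Rightarrow> 'a \<Rightarrow> bool" where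
  "qcqp_minimizer f h \<epsilon> \<alpha> w z d \<longleftrightarrow>
     is_arg_min (qcqp_objective f z) (qcqp_feasible h \<epsilon> \<alpha> w z) d"

end

theory Submission
  imports Defs
begin

text \<open>Completing the square shows that the feasible set of the QCQP is a closed ball, possibly
  empty, and the minimizer is the point of this ball closest to \<open>- grad f z\<close>. Existence and
  uniqueness are those of the metric projection, and (ii) is its variational inequality tested at
  the feasible point 0. On the boundary \<open>h z = \<epsilon>\<^sup>2\<close>, assumption (A3) says exactly that
  \<open>grad h z \<noteq> 0\<close>, so a short step along \<open>- grad h z\<close> is strictly feasible.\<close>

section \<open>Gradients, partial Jacobians and the gradient of the squared norm of
  \<open>grad_y g\<close>\<close>

lemma grad_eqI:
  assumes "GDERIV f z :> D"
  shows "grad f z = D"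
  unfolding grad_def
proof (rule the_equality)
  fix D' assume "GDERIV f z :> D'"
  then have "(\<lambda>v. v \<bullet> D') = (\<lambda>v. v \<bullet> D)"
    using assms unfolding gderiv_def by (rule has_derivative_unique)
  then show "D' = D"
    by (metis vector_eq_rdot inner_commute)
qed fact

lemma jacobian_mult:
  fixes F :: "real ^ 'n \<Rightarrow> real ^ 'm"
  assumes "(F has_derivative F') (at x)"
  shows "jacobian F (at x) *v v = F' v"
proof -
  have "(F has_derivative (\<lambda>v. jacobian F (at x) *v v)) (at x)"
    using assms unfolding jacobian_works[symmetric] by (rule differentiableI)
  from has_derivative_unique[OF this assms] show ?thesis by (rule fun_cong)
qed

text \<open>Riesz representation in coordinates: the functional \<open>g' (0, _)\<close> is
  determined by its values on the orthonormal \<open>Basis\<close>. The formula exhibits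
  \<open>grad_y g z\<close> as a fixed linear image of the derivative of \<open>g\<close> at
  \<open>z\<close>.\<close>

lemma grad_y_eq:
  fixes g :: "'a::real_normed_vector \<times> 'b::euclidean_space \<Rightarrow> real"
  assumes "(g has_derivative g') (at z)"
  shows "grad_y g z = (\<Sum>i\<in>Basis. g' (0, i) *\<^sub>R i)"
  unfolding grad_y_def
proof (rule grad_eqI)
  interpret g': bounded_linear g' using assms by (rule has_derivative_bounded_linear)
  have "((\<lambda>y. g (fst z, y)) has_derivative (\<lambda>v. g' (0, v))) (at (snd z))"
    using has_derivative_compose[OF has_derivative_Pair[OF has_derivative_const has_derivative_ident],
        of g g' "fst z" "snd z" UNIV] assms by simp
  moreover have "g' (0, v) = v \<bullet> (\<Sum>i\<in>Basis. g' (0, i) *\<^sub>R i)" for v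
  proof -
    have "linear (\<lambda>v. g' (0, v))"
      using g'.add[of "(0, _)" "(0, _)"] g'.scaleR[of _ "(0, _)"] by (intro linearI) simp_all
    from linear_sum[OF this, of "\<lambda>i. (v \<bullet> i) *\<^sub>R i" Basis]
    have "g' (0, v) = (\<Sum>i\<in>Basis. (v \<bullet> i) *\<^sub>R g' (0, i))"
      unfolding linear_cmul[OF \<open>linear _\<close>] euclidean_representation .
    then show ?thesis by (simp add: inner_sum_right mult.commute)
  qed
  ultimately show "GDERIV (\<lambda>y. g (fst z, y)) (snd z) :> (\<Sum>i\<in>Basis. g' (0, i) *\<^sub>R i)"
    unfolding gderiv_def by (rule has_derivative_eq_rhs[OF _ ext])
qed

text \<open>By \<open>grad_y_eq\<close>, \<open>grad_y g\<close> is a fixed linear map applied to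
  the derivative \<open>g'\<close>, so it inherits the differentiability of
  \<open>g'\<close>.\<close>

lemma grad_y_differentiable:
  fixes g :: "'a::real_normed_vector \<times> 'b::euclidean_space \<Rightarrow> real"
  assumes "twice_cont_differentiable g"
  shows "grad_y g differentiable (at z)"
proof -
  obtain g' where g': "\<And>z. (g has_derivative blinfun_apply (g' z)) (at z)"
    and "cont_differentiable g'"
    using assms unfolding twice_cont_differentiable_def by blast
  then obtain g'' where g'': "(g' has_derivative g'') (at z)"
    unfolding cont_differentiable_def by blast
  have eq: "grad_y g = (\<lambda>z. \<Sum>i\<in>Basis. blinfun_apply (g' z) (0, i) *\<^sub>R i)"
    using grad_y_eq[OF g'] by blast
  have "(grad_y g has_derivative (\<lambda>v. \<Sum>i\<in>Basis. blinfun_apply (g'' v) (0, i) *\<^sub>R i)) (at z)"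
    unfolding eq by (auto intro!: derivative_eq_intros g'' simp: blinfun.zero_right)
  then show ?thesis unfolding differentiable_def by blast
qed

text \<open>Product rule for \<open>grad_y g z \<bullet> grad_y g z\<close>. The total derivative of
  \<open>grad_y g\<close> splits into the blocks \<open>hess_yx g z\<close> and
  \<open>hess_yy g z\<close>, and moving each block to the other side of the inner product
  transposes it.\<close>

lemma grad_norm_grad_y_squared:
  fixes g :: "(real ^ 'n) \<times> (real ^ 'm) \<Rightarrow> real"
  assumes "twice_cont_differentiable g"
  shows "grad (\<lambda>z. (norm (grad_y g z))\<^sup>2) z =
    2 *\<^sub>R (transpose (hess_yx g z) *v grad_y g z, transpose (hess_yy g z) *v grad_y g z)"
proof (rule grad_eqI)
  obtain G where G: "(grad_y g has_derivative G) (at z)"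
    using grad_y_differentiable[OF assms] unfolding differentiable_def by blast
  interpret G: bounded_linear G using G by (rule has_derivative_bounded_linear)
  \<comment> \<open>\<open>hess_yx\<close> is a Jacobian along the slice where \<open>y\<close> is
    frozen; the chain rule identifies it with the restriction of \<open>G\<close> to vectors
    \<open>(v, 0)\<close>.\<close>
  have "((\<lambda>x. grad_y g (x, snd z)) has_derivative (\<lambda>v. G (v, 0))) (at (fst z))"
    using has_derivative_compose[OF has_derivative_Pair[OF has_derivative_ident has_derivative_const],
        of "grad_y g" G "fst z" "snd z" UNIV] G by simp
  then have x: "hess_yx g z *v v = G (v, 0)" for v
    unfolding hess_yx_def by (rule jacobian_mult)
  have "((\<lambda>y. grad_y g (fst z, y)) has_derivative (\<lambda>v. G (0, v))) (at (snd z))"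
    using has_derivative_compose[OF has_derivative_Pair[OF has_derivative_const has_derivative_ident],
        of "grad_y g" G "fst z" "snd z" UNIV] G by simp
  then have y: "hess_yy g z *v v = G (0, v)" for v
    unfolding hess_yy_def by (rule jacobian_mult)
  have "((\<lambda>z. grad_y g z \<bullet> grad_y g z) has_derivative
      (\<lambda>v. grad_y g z \<bullet> G v + G v \<bullet> grad_y g z)) (at z)"
    by (intro derivative_intros G)
  moreover have "grad_y g z \<bullet> G v + G v \<bullet> grad_y g z =
    v \<bullet> (2 *\<^sub>R (transpose (hess_yx g z) *v grad_y g z, transpose (hess_yy g z) *v grad_y g z))" for v
  proof -
    have "G v = hess_yx g z *v fst v + hess_yy g z *v snd v"
      unfolding x y by (simp flip: G.add)
    moreover have "fst v \<bullet> (grad_y g z v* hess_yx g z) = grad_y g z \<bullet> (hess_yx g z *v fst v)"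
      and "snd v \<bullet> (grad_y g z v* hess_yy g z) = grad_y g z \<bullet> (hess_yy g z *v snd v)"
      by (metis dot_lmul_matrix inner_commute)+
    ultimately show ?thesis
      by (simp add: inner_prod_def inner_add_left inner_add_right inner_commute[of _ "grad_y g z"])
  qed
  ultimately show "GDERIV (\<lambda>z. (norm (grad_y g z))\<^sup>2) z :>
    2 *\<^sub>R (transpose (hess_yx g z) *v grad_y g z, transpose (hess_yy g z) *v grad_y g z)"
    unfolding gderiv_def power2_norm_eq_inner by simp
qed

text \<open>The transpose of a block row stacks the transposed blocks, so the components indexed by
  \<open>Inl\<close> and \<open>Inr\<close> are those of the two separate products. This bridges the
  sum-indexed matrix of (A3) and the pair-valued gradient.\<close>

lemma mem_null_space_transpose_block_row:
  fixes A :: "real ^ 'n ^ 'k" and B :: "real ^ 'm ^ 'k"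
  assumes "transpose A *v v = 0" and "transpose B *v v = 0"
  shows "v \<in> null_space (transpose (block_row A B))"
proof -
  have "(transpose (block_row A B) *v v) $ j = 0" for j
  proof (cases j)
    case (Inl a)
    then have "(transpose (block_row A B) *v v) $ j = (transpose A *v v) $ a"
      by (simp add: matrix_vector_mult_def transpose_def block_row_def)
    with assms show ?thesis by simp
  next
    case (Inr b)
    then have "(transpose (block_row A B) *v v) $ j = (transpose B *v v) $ b"
      by (simp add: matrix_vector_mult_def transpose_def block_row_def)
    with assms show ?thesis by simp
  qed
  then show ?thesis unfolding null_space_def by (simp add: vec_eq_iff)
qed

text \<open>Up to the factor 2, the gradient is the transposed block row applied to
  \<open>grad_y g z\<close>. If it vanished, \<open>grad_y g z\<close> would lie in the null space
  excluded by (A3).\<close>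

lemma grad_norm_grad_y_squared_nonzero:
  fixes g :: "(real ^ 'n) \<times> (real ^ 'm) \<Rightarrow> real"
  assumes "twice_cont_differentiable g" and "assumption_A3 g" and "grad_y g z \<noteq> 0"
  shows "grad (\<lambda>z. (norm (grad_y g z))\<^sup>2) z \<noteq> 0"
proof
  assume "grad (\<lambda>z. (norm (grad_y g z))\<^sup>2) z = 0"
  then have "transpose (hess_yx g z) *v grad_y g z = 0" and "transpose (hess_yy g z) *v grad_y g z = 0"
    unfolding grad_norm_grad_y_squared[OF assms(1)] by (simp_all add: zero_prod_def)
  then show False
    using mem_null_space_transpose_block_row assms(2,3) unfolding assumption_A3_def by blast
qed

section \<open>The QCQP as a projection onto a ball\<close>

text \<open>Divide the constraint by \<open>w\<close> and complete the square in
  \<open>d\<close>.\<close>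

lemma qcqp_feasible_set_eq_cball:
  fixes h :: "'a::real_inner \<Rightarrow> real"
  assumes "w > 0"
  shows "{d. qcqp_feasible h \<epsilon> \<alpha> w z d} = cball (- (1 / (2 * w)) *\<^sub>R grad h z)
    (sqrt ((norm (grad h z) / (2 * w))\<^sup>2 - \<alpha> * (h z - \<epsilon>\<^sup>2) / w))"
    (is "_ = cball ?c (sqrt ?R)")
proof (intro set_eqI)
  fix d
  have "(norm (d - ?c))\<^sup>2 - ?R =
      (grad h z \<bullet> d + \<alpha> * (h z - \<epsilon>\<^sup>2) + w * (norm d)\<^sup>2) / w"
    using assms unfolding power_divide power2_norm_eq_inner
    by (simp add: inner_add_left inner_add_right inner_commute field_simps power2_eq_square)
  then have "(norm (d - ?c))\<^sup>2 \<le> ?R \<longleftrightarrow>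
      (grad h z \<bullet> d + \<alpha> * (h z - \<epsilon>\<^sup>2) + w * (norm d)\<^sup>2) / w \<le> 0"
    by linarith
  also have "\<dots> \<longleftrightarrow> qcqp_feasible h \<epsilon> \<alpha> w z d"
    using assms unfolding qcqp_feasible_def by (simp add: divide_le_0_iff algebra_simps)
  finally have "qcqp_feasible h \<epsilon> \<alpha> w z d \<longleftrightarrow> (norm (d - ?c))\<^sup>2 \<le> ?R" ..
  \<comment> \<open>This also covers \<open>?R < 0\<close>: then \<open>sqrt ?R\<close> is negative
    as well, both sides are false and the ball is empty.\<close>
  also have "\<dots> \<longleftrightarrow> norm (d - ?c) \<le> sqrt ?R"
    using real_le_rsqrt sqrt_ge_absD[of "norm (d - ?c)" ?R] by auto
  finally show "d \<in> {d. qcqp_feasible h \<epsilon> \<alpha> w z d} \<longleftrightarrow> d \<in> cball ?c (sqrt ?R)"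
    by (simp add: dist_norm norm_minus_commute)
qed

text \<open>The objective is half the squared distance from \<open>d\<close> to
  \<open>- grad f z\<close>, and squaring is strictly increasing on nonnegative reals. The minimizer
  is thus a closest feasible point, in the form used by the library facts on projections.\<close>

lemma qcqp_minimizer_iff_closest:
  "qcqp_minimizer f h \<epsilon> \<alpha> w z d \<longleftrightarrow> qcqp_feasible h \<epsilon> \<alpha> w z d \<and>
    (\<forall>e. qcqp_feasible h \<epsilon> \<alpha> w z e \<longrightarrow> dist (- grad f z) d \<le> dist (- grad f z) e)"
proof -
  have "qcqp_objective f z e < qcqp_objective f z d \<longleftrightarrow>
      dist (- grad f z) e < dist (- grad f z) d" for d e
  proof -
    have "dist (- grad f z) x = norm (x + grad f z)" for x
      by (metis dist_commute dist_norm diff_minus_eq_add)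
    then show ?thesis
      unfolding qcqp_objective_def
      by (auto intro: power_strict_mono dest: power_less_imp_less_base)
  qed
  then show ?thesis
    unfolding qcqp_minimizer_def is_arg_min_def by (auto simp: not_less)
qed

lemma ex1_qcqp_minimizer:
  fixes f h :: "'a::euclidean_space \<Rightarrow> real"
  assumes "w > 0" and "qcqp_feasible h \<epsilon> \<alpha> w z d"
  shows "\<exists>!d. qcqp_minimizer f h \<epsilon> \<alpha> w z d"
proof -
  let ?S = "{d. qcqp_feasible h \<epsilon> \<alpha> w z d}"
  have S: "closed ?S" "convex ?S"
    unfolding qcqp_feasible_set_eq_cball[OF assms(1)] by simp_all
  have "?S \<noteq> {}" using assms(2) by blast
  show ?thesis
  proof
    show "qcqp_minimizer f h \<epsilon> \<alpha> w z (closest_point ?S (- grad f z))"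
      using closest_point_exists[OF S(1) \<open>?S \<noteq> {}\<close>] by (simp add: qcqp_minimizer_iff_closest)
  next
    fix e assume "qcqp_minimizer f h \<epsilon> \<alpha> w z e"
    then show "e = closest_point ?S (- grad f z)"
      using closest_point_unique[OF S(2,1)] by (simp add: qcqp_minimizer_iff_closest)
  qed
qed

lemma qcqp_minimizer_descent:
  fixes f h :: "'a::euclidean_space \<Rightarrow> real"
  assumes "w > 0" and "qcqp_feasible h \<epsilon> \<alpha> w z 0" and "qcqp_minimizer f h \<epsilon> \<alpha> w z d"
  shows "grad f z \<bullet> d \<le> - (norm d)\<^sup>2"
proof -
  let ?S = "{d. qcqp_feasible h \<epsilon> \<alpha> w z d}"
  have "convex ?S" "closed ?S"
    unfolding qcqp_feasible_set_eq_cball[OF assms(1)] by simp_all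
  \<comment> \<open>The segment from the projection \<open>d\<close> to the feasible point 0 makes
    no acute angle with the direction to \<open>- grad f z\<close>. Expanding the product gives
    \<open>grad f z \<bullet> d\<close> plus the squared norm of \<open>d\<close>.\<close>
  then have "(- grad f z - d) \<bullet> (0 - d) \<le> 0"
    by (rule any_closest_point_dot) (use assms in \<open>auto simp: qcqp_minimizer_iff_closest\<close>)
  then show ?thesis
    by (simp add: power2_norm_eq_inner inner_diff_left)
qed

section \<open>Strict feasibility and KKT points\<close>

lemma ex_qcqp_strictly_feasible:
  fixes h :: "'a::real_inner \<Rightarrow> real"
  assumes "\<alpha> > 0" and "w > 0" and "h z \<le> \<epsilon>\<^sup>2"
    and boundary: "h z = \<epsilon>\<^sup>2 \<Longrightarrow> grad h z \<noteq> 0"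
  shows "\<exists>d. qcqp_strictly_feasible h \<epsilon> \<alpha> w z d"
proof (cases "h z = \<epsilon>\<^sup>2")
  case True
  \<comment> \<open>The center of the feasible ball, which minimizes
    \<open>grad h z \<bullet> d + w * (norm d)\<^sup>2\<close> over all \<open>d\<close>.\<close>
  let ?d = "- (1 / (2 * w)) *\<^sub>R grad h z"
  have "grad h z \<bullet> ?d + w * (norm ?d)\<^sup>2 = - (norm (grad h z))\<^sup>2 / (4 * w)"
    using assms(2) unfolding power2_norm_eq_inner
    by (simp add: field_simps power2_eq_square)
  also have "\<dots> < 0" using boundary[OF True] assms(2) by simp
  finally have "qcqp_strictly_feasible h \<epsilon> \<alpha> w z ?d"
    unfolding qcqp_strictly_feasible_def using True by simp
  then show ?thesis ..
next
  case False
  \<comment> \<open>Off the boundary the zero step already leaves the positive slack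
    \<open>\<alpha> * (\<epsilon>\<^sup>2 - h z)\<close>.\<close>
  with assms have "qcqp_strictly_feasible h \<epsilon> \<alpha> w z 0"
    unfolding qcqp_strictly_feasible_def by (simp add: mult_pos_neg)
  then show ?thesis ..
qed

text \<open>The KKT multiplier certifies optimality of 0: weighting the constraint by
  \<open>\<mu>\<close> gives \<open>grad f z \<bullet> e \<ge> 0\<close> for every feasible
  \<open>e\<close>, so no feasible step brings 0 closer to \<open>- grad f z\<close>.\<close>

lemma KKT_point_imp_qcqp_minimizer_0:
  fixes f h :: "'a::real_inner \<Rightarrow> real"
  assumes "\<alpha> \<ge> 0" and "w \<ge> 0" and "KKT_point f h \<epsilon> z"
  shows "qcqp_minimizer f h \<epsilon> \<alpha> w z 0"
proof -
  obtain \<mu> where "\<mu> \<ge> 0" and stat: "grad f z + \<mu> *\<^sub>R grad h z = 0"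
    and le: "h z - \<epsilon>\<^sup>2 \<le> 0" and compl: "\<mu> * (h z - \<epsilon>\<^sup>2) = 0"
    using assms(3) unfolding KKT_point_def by blast
  have f: "grad f z = - \<mu> *\<^sub>R grad h z"
    using stat by (simp add: eq_neg_iff_add_eq_0)
  have "dist (- grad f z) 0 \<le> dist (- grad f z) e" if e: "qcqp_feasible h \<epsilon> \<alpha> w z e" for e
  proof -
    have "\<mu> * (grad h z \<bullet> e + \<alpha> * (h z - \<epsilon>\<^sup>2)) \<le> \<mu> * (- w * (norm e)\<^sup>2)"
      using e \<open>\<mu> \<ge> 0\<close> unfolding qcqp_feasible_def by (intro mult_left_mono)
    also have "\<dots> \<le> 0" using \<open>\<mu> \<ge> 0\<close> assms(2) by simp
    finally have "\<mu> * (grad h z \<bullet> e) + \<alpha> * (\<mu> * (h z - \<epsilon>\<^sup>2)) \<le> 0"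
      by (simp add: algebra_simps)
    \<comment> \<open>Complementarity removes the constant term, and stationarity turns
      \<open>\<mu> * (grad h z \<bullet> e)\<close> into
      \<open>- (grad f z \<bullet> e)\<close>.\<close>
    then have "0 \<le> grad f z \<bullet> e" using compl unfolding f by simp
    \<comment> \<open>The right side exceeds the left by
      \<open>2 * (grad f z \<bullet> e) + (norm e)\<^sup>2\<close>.\<close>
    then have "(norm (grad f z))\<^sup>2 \<le> (norm (grad f z + e))\<^sup>2"
      by (simp add: power2_norm_eq_inner inner_add_left inner_add_right inner_commute)
    then have "norm (grad f z) \<le> norm (grad f z + e)"
      by (rule power2_le_imp_le) simp
    then show ?thesis
      by (simp add: dist_norm norm_minus_commute add.commute)
  qed
  moreover have "qcqp_feasible h \<epsilon> \<alpha> w z 0"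
    using assms(1) le unfolding qcqp_feasible_def by (simp add: mult_nonneg_nonpos)
  ultimately show ?thesis by (simp add: qcqp_minimizer_iff_closest)
qed

theorem theorem1:
  fixes f g h :: "(real ^ 'n) \<times> (real ^ 'm) \<Rightarrow> real"
    and \<epsilon> \<alpha>\<^sub>b w :: real
    and z :: "(real ^ 'n) \<times> (real ^ 'm)"
  assumes "assumption_A1 f" and "assumption_A2 g" and "assumption_A3 g"
    and "h = (\<lambda>z. (norm (grad_y g z))\<^sup>2)"
    and "\<epsilon> > 0" and "\<alpha>\<^sub>b > 0" and "w > 0"
  shows "((\<exists>d. qcqp_feasible h \<epsilon> \<alpha>\<^sub>b w z d) \<longrightarrow> (\<exists>!d. qcqp_minimizer f h \<epsilon> \<alpha>\<^sub>b w z d))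
    \<and> (h z \<le> \<epsilon>\<^sup>2 \<longrightarrow> (\<exists>d. qcqp_strictly_feasible h \<epsilon> \<alpha>\<^sub>b w z d))
    \<and> (h z \<le> \<epsilon>\<^sup>2 \<longrightarrow> (\<forall>d. qcqp_minimizer f h \<epsilon> \<alpha>\<^sub>b w z d \<longrightarrow> grad f z \<bullet> d \<le> - (norm d)\<^sup>2))
    \<and> (h z > \<epsilon>\<^sup>2 \<longrightarrow> (\<forall>d. qcqp_minimizer f h \<epsilon> \<alpha>\<^sub>b w z d \<longrightarrow>
          grad h z \<bullet> d \<le> - \<alpha>\<^sub>b * (h z - \<epsilon>\<^sup>2) - w * (norm d)\<^sup>2
          \<and> - \<alpha>\<^sub>b * (h z - \<epsilon>\<^sup>2) - w * (norm d)\<^sup>2 \<le> 0))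
    \<and> (KKT_point f h \<epsilon> z \<longrightarrow> (\<forall>d. qcqp_minimizer f h \<epsilon> \<alpha>\<^sub>b w z d \<longleftrightarrow> d = 0))"
proof (intro conjI impI allI)
  show "\<exists>!d. qcqp_minimizer f h \<epsilon> \<alpha>\<^sub>b w z d" if "\<exists>d. qcqp_feasible h \<epsilon> \<alpha>\<^sub>b w z d"
    using that ex1_qcqp_minimizer[OF assms(7)] by blast
next
  assume "h z \<le> \<epsilon>\<^sup>2"
  have "grad h z \<noteq> 0" if "h z = \<epsilon>\<^sup>2"
  proof -
    \<comment> \<open>On the boundary the squared norm of \<open>grad_y g z\<close> equals
      \<open>\<epsilon>\<^sup>2\<close>, which is positive because \<epsilon> > 0; this makes (A3)
      applicable.\<close>
    have "grad_y g z \<noteq> 0" using that assms(4,5) by auto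
    then show ?thesis
      using assms(2,3) unfolding assms(4) assumption_A2_def
      by (simp add: grad_norm_grad_y_squared_nonzero)
  qed
  then show "\<exists>d. qcqp_strictly_feasible h \<epsilon> \<alpha>\<^sub>b w z d"
    by (rule ex_qcqp_strictly_feasible[where h = h, OF assms(6,7) \<open>h z \<le> \<epsilon>\<^sup>2\<close>])
next
  fix d assume "h z \<le> \<epsilon>\<^sup>2" and "qcqp_minimizer f h \<epsilon> \<alpha>\<^sub>b w z d"
  moreover from this have "qcqp_feasible h \<epsilon> \<alpha>\<^sub>b w z 0"
    using assms(6) unfolding qcqp_feasible_def by (simp add: mult_nonneg_nonpos)
  ultimately show "grad f z \<bullet> d \<le> - (norm d)\<^sup>2"
    using qcqp_minimizer_descent[OF assms(7)] by blast
next
  fix d assume "h z > \<epsilon>\<^sup>2" and "qcqp_minimizer f h \<epsilon> \<alpha>\<^sub>b w z d"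
  \<comment> \<open>The bound is feasibility of the minimizer, rearranged.\<close>
  then show "grad h z \<bullet> d \<le> - \<alpha>\<^sub>b * (h z - \<epsilon>\<^sup>2) - w * (norm d)\<^sup>2"
    unfolding qcqp_minimizer_iff_closest qcqp_feasible_def by linarith
next
  fix d assume "h z > \<epsilon>\<^sup>2"
  then have "0 \<le> \<alpha>\<^sub>b * (h z - \<epsilon>\<^sup>2)" and "0 \<le> w * (norm d)\<^sup>2"
    using assms(6,7) by simp_all
  then show "- \<alpha>\<^sub>b * (h z - \<epsilon>\<^sup>2) - w * (norm d)\<^sup>2 \<le> 0" by linarith
next
  fix d assume "KKT_point f h \<epsilon> z"
  then have 0: "qcqp_minimizer f h \<epsilon> \<alpha>\<^sub>b w z 0"
    using assms(6,7) by (intro KKT_point_imp_qcqp_minimizer_0 less_imp_le)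
  then have "qcqp_feasible h \<epsilon> \<alpha>\<^sub>b w z 0"
    by (simp add: qcqp_minimizer_iff_closest)
  \<comment> \<open>Feasibility of 0 supplies the nonempty feasible set; uniqueness then excludes
    every minimizer other than 0.\<close>
  with assms(7) have "\<exists>!d. qcqp_minimizer f h \<epsilon> \<alpha>\<^sub>b w z d"
    by (rule ex1_qcqp_minimizer)
  with 0 show "qcqp_minimizer f h \<epsilon> \<alpha>\<^sub>b w z d \<longleftrightarrow> d = 0" by blast
qed

end
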